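(* Let $q\le 7$ be a prime and let $V=\{\mathbf{0},\mathbf{v}_1,\dots,\mathbf{v}_{q-1}\}\subset\mathbb{Z}^n$ be a set of size $q$ such that $\mathbf{v}_1,\dots,\mathbf{v}_{q-1}$ generate $\mathbb{Z}^n$. Then every tiling of $\mathbb{Z}^n$ by translates of $V$ is a lattice tiling.
   Context: A tiling of $\mathbb{Z}^n$ by translates of $V$ is a family $\{V+l: l\in\mathcal{L}\}$, $\mathcal{L}\subset\mathbb{Z}^n$, such that every $x\in\mathbb{Z}^n$ can be written uniquely as $x=v+l$ with $v\in V$, $l\in\mathcal{L}$; it is a lattice tiling if $\mathcal{L}$ is a subgroup of $\mathbb{Z}^n$.
   Formalization: Since V={0,1} in Z with the odd integers as translation set is a tiling whose translation set is no subgroup, the conclusion is proved for tilings whose translation set contains 0, and for arbitrary tilings after translating the translation set by a suitable vector. *)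

theory Defs
  imports
    "HOL-Analysis.Finite_Cartesian_Product"
    "HOL-Computational_Algebra.Group_Closure"
    "HOL-Computational_Algebra.Primes"
begin

definition add_subgroup :: "'a::ab_group_add set \<Rightarrow> bool" where
  "add_subgroup H \<longleftrightarrow>
     0 \<in> H \<and> (\<forall>x\<in>H. \<forall>y\<in>H. x + y \<in> H) \<and> (\<forall>x\<in>H. - x \<in> H)"

definition tiling :: "(int ^ 'n) set \<Rightarrow> (int ^ 'n) set \<Rightarrow> bool" where
  "tiling V L \<longleftrightarrow> (\<forall>x. \<exists>!p. p \<in> V \<times> L \<and> x = fst p + snd p)"

text \<open>
  A lattice tiling necessarily has the origin in \<open>L\<close>. Translating a tiling gives a tiling, so
  tilings whose set \<open>L\<close> misses the origin can be compared with lattice tilings only after a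
  translation: for \<open>V = {0, 1}\<close> in \<open>\<int>\<close>, the odd numbers give a tiling but not a subgroup.
\<close>

definition lattice_tiling :: "(int ^ 'n) set \<Rightarrow> (int ^ 'n) set \<Rightarrow> bool" where
  "lattice_tiling V L \<longleftrightarrow> tiling V L \<and> add_subgroup L"

end

theory Submission
  imports Defs "HOL-Number_Theory.Cong"
begin

text \<open>
  Let \<open>f\<close> be the indicator function of \<open>L\<close>. The tiling property says that the sum \<open>A\<close> of the shifts
  by the elements of \<open>V\<close> maps \<open>f\<close> to 1. For a prime \<open>r\<close>, \<open>A^r\<close> is modulo \<open>r\<close> the sum of the shifts by
  \<open>r V\<close>. With \<open>r = q\<close> this shows that \<open>L\<close> is periodic under \<open>q V\<close>; with \<open>r \<noteq> q\<close> and a density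
  argument it shows that \<open>k V\<close> tiles for all \<open>k\<close> prime to \<open>q\<close>. Hence every line in a direction
  \<open>v\<^sub>i - v\<^sub>j\<close> meets \<open>L\<close> in exactly one residue class modulo \<open>q\<close>.

  Let \<open>height y\<close> be the \<open>t\<close> modulo \<open>q\<close> with \<open>y - t v\<^sub>1 \<in> L\<close>. Along each further \<open>v\<^sub>j\<close> it is an
  orthomorphism of \<open>\<int>/q\<close>. For \<open>q \<le> 5\<close> all of these are affine; for \<open>q = 7\<close> a non-affine one cannot
  occur in a plane spanned by two of the vectors. A function that is affine in each direction and whose
  slopes never vanish has constant slopes, so \<open>height\<close> is affine and \<open>L\<close> is a coset of a subgroup.
\<close>

section \<open>Orthomorphisms of small cyclic groups\<close>

text \<open>On the finite group \<open>\<int>/q\<close> injectivity of \<open>b\<close> and of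
  \<open>b - id\<close> already makes both of them permutations.\<close>

definition orthomorphism :: "int \<Rightarrow> (int \<Rightarrow> int) \<Rightarrow> bool" where
  "orthomorphism q b \<longleftrightarrow>
     (\<forall>s t. [b s = b t] (mod q) \<longrightarrow> [s = t] (mod q)) \<and>
     (\<forall>s t. [b s - s = b t - t] (mod q) \<longrightarrow> [s = t] (mod q))"

text \<open>Models the heights on two parallel lines in direction \<open>v j\<close>, the second
  displaced by \<open>d\<close> times \<open>v i\<close>. The three exclusions come from the
  differences \<open>v i - v 0\<close>, \<open>v i - v 1\<close> and
  \<open>v i - v j\<close>.\<close>

definition row_shift :: "nat \<Rightarrow> nat \<Rightarrow> (int \<Rightarrow> int) \<Rightarrow> (int \<Rightarrow> int) \<Rightarrow> bool" where
  "row_shift q d a b \<longleftrightarrow> (\<forall>t. \<not> [b t = a t] (mod int q) \<and> \<not> [b t = a t + int d] (mod int q) \<and>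
     \<not> [b t = a (t + int d)] (mod int q))"

text \<open>The offset \<open>z\<close> normalises a row. Using one \<open>z\<close> for several
  rows preserves the relations between them.\<close>

definition residue_row :: "nat \<Rightarrow> int \<Rightarrow> (int \<Rightarrow> int) \<Rightarrow> int list" where
  "residue_row q z f = map (\<lambda>i. (f (int i) - z) mod int q) [0..<q]"

definition affine_list :: "nat \<Rightarrow> int list \<Rightarrow> bool" where
  "affine_list q a \<longleftrightarrow> list_all (\<lambda>i. (a ! i - a ! 0 - int i * (a ! 1 - a ! 0)) mod int q = 0) [0..<q]"

text \<open>The list of previous values is in reverse order, so that \<open>d\<close> is the distance to its head.\<close>

primrec extends :: "int \<Rightarrow> int \<Rightarrow> int list \<Rightarrow> int \<Rightarrow> bool" where
  "extends q d [] y = True"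
| "extends q d (x # xs) y \<longleftrightarrow> x \<noteq> y \<and> (y - x) mod q \<noteq> d \<and> extends q (d + 1) xs y"

text \<open>
  The search functions are first-order because \<open>code_simp\<close> also rewrites below abstractions, where it
  would unfold a search with symbolic arguments.
\<close>

fun completions :: "int \<Rightarrow> int list \<Rightarrow> int list list \<Rightarrow> int list list" where
  "completions q b [] = [rev b]"
| "completions q b ([] # Ds) = []"
| "completions q b ((y # D) # Ds) =
     (if extends q 1 b y then completions q (y # b) Ds @ completions q b (D # Ds)
      else completions q b (D # Ds))"

definition full_domains :: "nat \<Rightarrow> int list list" where
  "full_domains q = replicate q [0..int q - 1]"

text \<open>At each position the values forbidden by \<open>row_shift\<close> are deleted;
  \<open>rotate d a\<close> aligns the value of \<open>a\<close> at \<open>t + d\<close> with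
  position \<open>t\<close>.\<close>

definition restrict_domains :: "nat \<Rightarrow> nat \<Rightarrow> int list \<Rightarrow> int list list \<Rightarrow> int list list" where
  "restrict_domains q d a Ds =
     map (\<lambda>(x, z, D). removeAll x (removeAll z (removeAll ((x + int d) mod int q) D)))
       (zip a (zip (rotate d a) Ds))"

primrec no_third_row :: "int list \<Rightarrow> int list list \<Rightarrow> bool" where
  "no_third_row a [] = True"
| "no_third_row a (b # bs) \<longleftrightarrow>
     completions 7 [] (restrict_domains 7 6 a (restrict_domains 7 5 b (full_domains 7))) = [] \<and>
     no_third_row a bs"

primrec affine_or_isolated :: "int list list \<Rightarrow> bool" where
  "affine_or_isolated [] = True"
| "affine_or_isolated (a # as) \<longleftrightarrow>
     (affine_list 7 a \<or> no_third_row a (completions 7 [] (restrict_domains 7 1 a (full_domains 7)))) \<and>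
     affine_or_isolated as"

section \<open>Search results for \<open>q = 3\<close>, \<open>5\<close> and
  \<open>7\<close>\<close>

lemma completions_3_affine: "list_all (affine_list 3) (completions 3 [] (full_domains 3))"
  by code_simp

lemma completions_5_affine: "list_all (affine_list 5) (completions 5 [] (full_domains 5))"
  by code_simp

text \<open>
  Of the 19 orthomorphisms of \<open>\<int>/7\<close> fixing 0, 14 are not affine. Each of these admits 8 rows at
  distance 1, and none of these pairs admits a row at distance 6 from the first and 5 from the second.
\<close>
lemma completions_7_affine_or_isolated:
  "affine_or_isolated (completions 7 [] ([0] # tl (full_domains 7)))"
  by code_simp

lemma no_third_rowD:
  "no_third_row a bs \<Longrightarrow> b \<in> set bs \<Longrightarrow>
   completions 7 [] (restrict_domains 7 6 a (restrict_domains 7 5 b (full_domains 7))) = []"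
  by (induction bs) auto

lemma affine_or_isolatedD:
  "affine_or_isolated as \<Longrightarrow> a \<in> set as \<Longrightarrow> affine_list 7 a \<or>
   no_third_row a (completions 7 [] (restrict_domains 7 1 a (full_domains 7)))"
  by (induction as) auto

section \<open>Completeness of the search\<close>

lemma extends_iff:
  "extends q d xs y \<longleftrightarrow> (\<forall>k<length xs. xs ! k \<noteq> y \<and> (y - xs ! k) mod q \<noteq> d + int k)"
proof (induction xs arbitrary: d)
  case (Cons x xs)
  then show ?case
    by (auto simp: All_less_Suc2 algebra_simps)
qed simp

text \<open>This turns the computed lists into statements about all orthomorphisms: an admissible
  list cannot be missed. Here \<open>b\<close> holds the values already chosen, newest
  first.\<close>

lemma completions_complete:
  assumes "list_all2 (\<lambda>y D. y \<in> set D) ys Ds"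
    and "\<And>i. i < length ys \<Longrightarrow> extends q 1 (rev (take i ys) @ b) (ys ! i)"
  shows "rev b @ ys \<in> set (completions q b Ds)"
  using assms
proof (induction q b Ds arbitrary: ys rule: completions.induct)
  case (3 q b y D Ds)
  then obtain y' ys' where ys: "ys = y' # ys'" and y': "y' = y \<or> y' \<in> set D"
    and ys': "list_all2 (\<lambda>y D. y \<in> set D) ys' Ds"
    by (cases ys) auto
  show ?case
  proof (cases "y' = y")
    case True
    have ext: "extends q 1 b y"
      using "3.prems"(2)[of 0] ys True by simp
    have "rev (y # b) @ ys' \<in> set (completions q (y # b) Ds)"
      using "3.prems"(2)[of "Suc _"] ys True by (intro "3.IH"(1)[OF ext ys']) auto
    then show ?thesis
      using ext ys True by simp
  next
    case False
    then have D: "list_all2 (\<lambda>y D. y \<in> set D) ys (D # Ds)"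
      using y' ys ys' by simp
    \<comment> \<open>Both outcomes of the test on \<open>y\<close> go on to search
      \<open>D\<close>, hence two induction hypotheses.\<close>
    then have "rev b @ ys \<in> set (completions q b (D # Ds))"
      using "3.IH"(2,3) "3.prems"(2) by blast
    then show ?thesis
      by simp
  qed
qed (auto simp: list_all2_Cons2)

lemma not_cong_int_less:
  assumes "j < i" "i < q"
  shows "\<not> [int i = int j] (mod int q)"
  using assms by (simp add: cong_int_iff cong_def)

lemma residue_row_nth: "i < q \<Longrightarrow> residue_row q z f ! i = (f (int i) - z) mod int q"
  by (simp add: residue_row_def)

lemma length_residue_row [simp]: "length (residue_row q z f) = q"
  by (simp add: residue_row_def)

lemma residue_row_full_domains: "list_all2 (\<lambda>y D. y \<in> set D) (residue_row q z f) (full_domains q)"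
  by (auto simp: list_all2_conv_all_nth full_domains_def residue_row_nth)

text \<open>Repeated values contradict injectivity of \<open>b\<close>, and a difference of values
  equal to the difference of positions contradicts injectivity of \<open>b - id\<close>; the offset
  \<open>z\<close> cancels in both.\<close>

lemma residue_row_completions:
  assumes "orthomorphism (int q) b"
    and "list_all2 (\<lambda>y D. y \<in> set D) (residue_row q z b) Ds"
  shows "residue_row q z b \<in> set (completions (int q) [] Ds)"
proof -
  let ?r = "\<lambda>i. (b (int i) - z) mod int q"
  have distinct: "?r j \<noteq> ?r i \<and> (?r i - ?r j) mod int q \<noteq> int (i - j)" if ij: "j < i" "i < q" for i j
  proof (intro conjI notI)
    note not_cong = not_cong_int_less[OF ij]
    show False if "?r j = ?r i"
    proof -
      have "[b (int i) = b (int j)] (mod int q)"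
        using that by (simp add: cong_iff_dvd_diff mod_eq_dvd_iff dvd_diff_commute)
      then show False
        using assms not_cong unfolding orthomorphism_def by blast
    qed
    show False if "(?r i - ?r j) mod int q = int (i - j)"
    proof -
      have "(b (int i) - b (int j)) mod int q = int (i - j)"
        using that by (simp add: mod_diff_eq)
      then have "[b (int i) - b (int j) = int i - int j] (mod int q)"
        using ij by (metis cong_mod_left cong_refl less_imp_le of_nat_diff)
      then have "[b (int i) - int i = b (int j) - int j] (mod int q)"
        by (simp add: cong_iff_dvd_diff algebra_simps)
      then show False
        using assms not_cong unfolding orthomorphism_def by blast
    qed
  qed
  have "extends (int q) 1 (rev (take i (residue_row q z b)) @ []) (residue_row q z b ! i)"
    if i: "i < length (residue_row q z b)" for i
    unfolding extends_iff
  proof (intro allI impI)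
    fix k assume "k < length (rev (take i (residue_row q z b)) @ [])"
    then have k: "k < i" using i by simp
    have "(rev (take i (residue_row q z b)) @ []) ! k = ?r (i - Suc k)"
      using k i by (simp add: rev_nth residue_row_nth)
    \<comment> \<open>Entry \<open>k\<close> of the reversed prefix lies \<open>k + 1\<close>
      positions back, which is why the search starts with distance 1.\<close>
    moreover have "i - (i - Suc k) = Suc k"
      using k by simp
    ultimately show "(rev (take i (residue_row q z b)) @ []) ! k \<noteq> residue_row q z b ! i \<and>
        (residue_row q z b ! i - (rev (take i (residue_row q z b)) @ []) ! k) mod int q \<noteq> 1 + int k"
      using distinct[of "i - Suc k" i] k i by (simp add: residue_row_nth)
  qed
  then have "rev [] @ residue_row q z b \<in> set (completions (int q) [] Ds)"
    by (intro completions_complete assms(2))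
  then show ?thesis by simp
qed

lemma affine_list_residue_rowD:
  assumes "affine_list q (residue_row q z a)" and "1 < q" and "i < q"
  shows "[a (int i) = a 0 + int i * (a 1 - a 0)] (mod int q)"
proof -
  define r where "r i = (a (int i) - z) mod int q" for i
  have "(r i - r 0 - int i * (r 1 - r 0)) mod int q = 0"
    using assms by (auto simp: affine_list_def list_all_iff r_def residue_row_def)
  then have "[r i - r 0 - int i * (r 1 - r 0) = 0] (mod int q)"
    by (simp add: cong_def)
  moreover have "[r k = a (int k) - z] (mod int q)" for k
    by (simp add: r_def cong_def)
  then have "[r i - r 0 - int i * (r 1 - r 0) =
      (a (int i) - z) - (a (int 0) - z) - int i * ((a (int 1) - z) - (a (int 0) - z))] (mod int q)"
    by (intro cong_diff cong_mult cong_refl)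
  ultimately have "[(a (int i) - z) - (a (int 0) - z) - int i * ((a (int 1) - z) - (a (int 0) - z)) = 0] (mod int q)"
    using cong_sym cong_trans by blast
  then show ?thesis
    by (simp add: cong_iff_dvd_diff algebra_simps)
qed

lemma row_shift_restrict_domains:
  assumes rows: "row_shift q d a b"
    and per: "\<And>t. [a (t + int q) = a t] (mod int q)"
    and "d < q"
    and Ds: "list_all2 (\<lambda>y D. y \<in> set D) (residue_row q z b) Ds"
  shows "list_all2 (\<lambda>y D. y \<in> set D) (residue_row q z b) (restrict_domains q d (residue_row q z a) Ds)"
proof -
  let ?r = "\<lambda>f i. (f (int i) - z) mod int q"
  have "?r b i \<noteq> ?r a i \<and> ?r b i \<noteq> ?r a ((d + i) mod q) \<and> ?r b i \<noteq> (?r a i + int d) mod int q"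
    if i: "i < q" for i
  proof (intro conjI notI)
    assume "?r b i = ?r a i"
    then have "[b (int i) = a (int i)] (mod int q)"
      by (simp add: cong_iff_dvd_diff mod_eq_dvd_iff)
    then show False using rows unfolding row_shift_def by blast
  next
    assume "?r b i = ?r a ((d + i) mod q)"
    then have "[b (int i) = a (int ((d + i) mod q))] (mod int q)"
      by (simp add: cong_iff_dvd_diff mod_eq_dvd_iff)
    \<comment> \<open>Since \<open>d\<close> and \<open>i\<close> are below \<open>q\<close>, the
      index wraps around at most once, and one use of periodicity suffices.\<close>
    moreover have "[a (int i + int d) = a (int ((d + i) mod q))] (mod int q)"
    proof (cases "d + i < q")
      case True
      then show ?thesis by (simp add: add.commute)
    next
      case False
      then have "(d + i) mod q = d + i - q"
        using i \<open>d < q\<close> by (simp add: le_mod_geq)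
      moreover have "int (d + i - q) + int q = int i + int d"
        using False by simp
      ultimately show ?thesis
        using per[of "int (d + i - q)"] by (simp add: add.commute)
    qed
    ultimately have "[b (int i) = a (int i + int d)] (mod int q)"
      using cong_sym cong_trans by blast
    then show False using rows unfolding row_shift_def by blast
  next
    assume "?r b i = (?r a i + int d) mod int q"
    then have "(b (int i) - z) mod int q = (a (int i) - z + int d) mod int q"
      by (simp add: mod_add_left_eq)
    then have "[b (int i) = a (int i) + int d] (mod int q)"
      by (simp add: cong_iff_dvd_diff mod_eq_dvd_iff algebra_simps)
    then show False using rows unfolding row_shift_def by blast
  qed
  moreover have "rotate d (residue_row q z a) ! i = ?r a ((d + i) mod q)" if "i < q" for i
    using that by (simp add: nth_rotate residue_row_nth)
  ultimately show ?thesis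
    using Ds by (auto simp: list_all2_conv_all_nth restrict_domains_def residue_row_nth)
qed

lemma orthomorphism_3_5_affine:
  assumes "orthomorphism (int q) a" and "q = 3 \<or> q = 5" and "i < q"
  shows "[a (int i) = a 0 + int i * (a 1 - a 0)] (mod int q)"
proof (rule affine_list_residue_rowD)
  show "affine_list q (residue_row q 0 a)"
    using residue_row_completions[OF assms(1) residue_row_full_domains, of 0] assms(2)
      completions_3_affine completions_5_affine
    by (auto simp: list_all_iff)
qed (use assms in auto)

text \<open>The rows \<open>a\<close>, \<open>b\<close>, \<open>c\<close> stand at positions 0, 1
  and 6, so their pairwise distances are 1, 6 and 5. A non-affine \<open>a\<close> would leave no
  candidate for \<open>c\<close>.\<close>

lemma orthomorphism_7_affine:
  assumes ortho: "orthomorphism 7 a" "orthomorphism 7 b" "orthomorphism 7 c"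
    and per: "\<And>t. [a (t + 7) = a t] (mod 7)" "\<And>t. [b (t + 7) = b t] (mod 7)"
    and rows: "row_shift 7 1 a b" "row_shift 7 6 a c" "row_shift 7 5 b c" and "i < 7"
  shows "[a (int i) = a 0 + int i * (a 1 - a 0)] (mod 7)"
proof -
  let ?row = "residue_row 7 (a 0)"
  note mem = residue_row_completions[of 7, simplified]
  have fits: "list_all2 (\<lambda>y D. y \<in> set D) (?row b) (restrict_domains 7 1 (?row a) (full_domains 7))"
    "list_all2 (\<lambda>y D. y \<in> set D) (?row c)
      (restrict_domains 7 6 (?row a) (restrict_domains 7 5 (?row b) (full_domains 7)))"
    using rows per by (auto intro!: row_shift_restrict_domains residue_row_full_domains)
  \<comment> \<open>Subtracting \<open>a 0\<close> from all three rows makes the first one start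
    with 0, the only case searched.\<close>
  have "?row a = 0 # tl (?row a)"
    by (simp add: residue_row_def upt_conv_Cons)
  moreover have "full_domains 7 = [0..6] # tl (full_domains 7)"
    by (simp add: full_domains_def numeral_eq_Suc)
  ultimately have "list_all2 (\<lambda>y D. y \<in> set D) (?row a) ([0] # tl (full_domains 7))"
    using residue_row_full_domains[of 7 "a 0" a] by (metis list.inject list.set_intros(1) list_all2_Cons)
  then have "affine_list 7 (?row a) \<or>
      no_third_row (?row a) (completions 7 [] (restrict_domains 7 1 (?row a) (full_domains 7)))"
    using affine_or_isolatedD[OF completions_7_affine_or_isolated] mem[OF ortho(1)] by blast
  moreover have "\<not> no_third_row (?row a) (completions 7 [] (restrict_domains 7 1 (?row a) (full_domains 7)))"
    using no_third_rowD[OF _ mem[OF ortho(2) fits(1)]] mem[OF ortho(3) fits(2)] by force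
  ultimately show ?thesis
    using affine_list_residue_rowD[of 7 "a 0" a i] \<open>i < 7\<close> by simp
qed


section \<open>Sums of shifts\<close>

definition shift_sum :: "'i set \<Rightarrow> ('i \<Rightarrow> int ^ 'n) \<Rightarrow> (int ^ 'n \<Rightarrow> int) \<Rightarrow> int ^ 'n \<Rightarrow> int" where
  "shift_sum I u h x = (\<Sum>i\<in>I. h (x - u i))"

lemma shift_sum_combination:
  "shift_sum I u (\<lambda>x. \<Sum>k\<in>K. c k * h k (x - w k)) x = (\<Sum>k\<in>K. c k * shift_sum I u (h k) (x - w k))"
  unfolding shift_sum_def sum_distrib_left
  by (subst sum.swap) (simp add: algebra_simps)

lemma shift_sum_const_funpow:
  "(shift_sum I u ^^ k) (\<lambda>_. c) = (\<lambda>_. int (card I) ^ k * c)"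
  by (induction k) (auto simp: shift_sum_def)

text \<open>The binomial theorem for two commuting operators: the shift by \<open>u i\<close> and
  \<open>shift_sum I u\<close>.\<close>

lemma shift_sum_insert_funpow:
  assumes "finite I" "i \<notin> I"
  shows "(shift_sum (insert i I) u ^^ r) h =
    (\<lambda>x. \<Sum>k\<le>r. int (r choose k) * (shift_sum I u ^^ (r - k)) h (x - int k *s u i))"
proof (induction r)
  case (Suc r)
  let ?H = "\<lambda>k. (shift_sum I u ^^ k) h"
  show ?case
  proof
    fix x
    have step: "shift_sum (insert i I) u g x = g (x - u i) + shift_sum I u g x" for g
      using assms by (simp add: shift_sum_def)
    have "(shift_sum (insert i I) u ^^ Suc r) h x =
        (\<Sum>k\<le>r. int (r choose k) * ?H (r - k) (x - u i - int k *s u i)) +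
        (\<Sum>k\<le>r. int (r choose k) * shift_sum I u (?H (r - k)) (x - int k *s u i))"
      using shift_sum_combination[where I = I and u = u and K = "{..r}" and c = "\<lambda>k. int (r choose k)"
          and h = "\<lambda>k. ?H (r - k)" and w = "\<lambda>k. int k *s u i" and x = x]
      by (simp only: funpow.simps comp_apply Suc.IH step)
    also have "(\<Sum>k\<le>r. int (r choose k) * ?H (r - k) (x - u i - int k *s u i)) =
        (\<Sum>k\<le>r. int (r choose k) * ?H (r - k) (x - int (Suc k) *s u i))"
      by (intro sum.cong refl arg_cong2[where f = "(*)"] arg_cong[where f = "?H _"])
        (simp add: vec_eq_iff algebra_simps)
    also have "(\<Sum>k\<le>r. int (r choose k) * shift_sum I u (?H (r - k)) (x - int k *s u i)) =
        (\<Sum>k\<le>r. int (r choose k) * ?H (Suc r - k) (x - int k *s u i))"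
      by (intro sum.cong refl) (simp add: Suc_diff_le)
    \<comment> \<open>The new term vanishes because \<open>r choose Suc r\<close> is 0. Splitting
      off \<open>k = 0\<close> then prepares for Pascal's rule.\<close>
    also have "\<dots> = (\<Sum>k\<le>Suc r. int (r choose k) * ?H (Suc r - k) (x - int k *s u i))"
      by simp
    also have "\<dots> = ?H (Suc r) x +
        (\<Sum>k\<le>r. int (r choose Suc k) * ?H (r - k) (x - int (Suc k) *s u i))"
      by (subst sum.atMost_Suc_shift) (simp del: of_nat_Suc)
    finally show "(shift_sum (insert i I) u ^^ Suc r) h x =
        (\<Sum>k\<le>Suc r. int (Suc r choose k) * ?H (Suc r - k) (x - int k *s u i))"
      by (subst sum.atMost_Suc_shift)
        (simp add: sum.distrib algebra_simps del: of_nat_Suc funpow.simps)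
  qed
qed simp

text \<open>The Frobenius identity in the ring of shifts, by adding one shift at a time: the inner
  binomial coefficients are divisible by \<open>r\<close>, so only the two extreme terms
  survive.\<close>

lemma shift_sum_frobenius:
  assumes "prime r" "finite I"
  shows "[(shift_sum I u ^^ r) h x = shift_sum I (\<lambda>i. int r *s u i) h x] (mod int r)"
  using \<open>finite I\<close>
proof (induction I arbitrary: x rule: finite_induct)
  case empty
  \<comment> \<open>A positive exponent is essential here: the zeroth power of the empty sum would
    be the identity, not 0.\<close>
  have "r = Suc (r - 1)"
    using \<open>prime r\<close> prime_gt_0_nat by auto
  then have "(shift_sum {} u ^^ r) h x = shift_sum {} u ((shift_sum {} u ^^ (r - 1)) h) x"
    by (metis comp_apply funpow.simps(2))
  moreover have "shift_sum {} u' g x = 0" for u' :: "'a \<Rightarrow> int ^ 'b" and g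
    by (simp add: shift_sum_def)
  ultimately show ?case
    by simp
next
  case (insert i I)
  let ?t = "\<lambda>k. int (r choose k) * (shift_sum I u ^^ (r - k)) h (x - int k *s u i)"
  have r: "r > 0"
    using \<open>prime r\<close> prime_gt_0_nat by auto
  have "{..r} = insert 0 (insert r {0<..<r})"
    using r by auto
  then have "(shift_sum (insert i I) u ^^ r) h x = ?t 0 + (?t r + (\<Sum>k\<in>{0<..<r}. ?t k))"
    using insert.hyps r by (simp add: shift_sum_insert_funpow)
  moreover have "[(\<Sum>k\<in>{0<..<r}. ?t k) = 0] (mod int r)"
    unfolding cong_0_iff
  proof (intro dvd_sum dvd_mult2)
    fix k assume "k \<in> {0<..<r}"
    then show "int r dvd int (r choose k)"
      using \<open>prime r\<close> by (auto intro!: dvd_choose_prime)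
  qed
  then have "[?t 0 + (?t r + (\<Sum>k\<in>{0<..<r}. ?t k)) =
      shift_sum I (\<lambda>i. int r *s u i) h x + (?t r + 0)] (mod int r)"
    using insert.IH[of x] by (intro cong_add cong_refl) simp_all
  moreover have "shift_sum I (\<lambda>i. int r *s u i) h x + (?t r + 0) =
      shift_sum (insert i I) (\<lambda>i. int r *s u i) h x"
    using insert.hyps by (simp add: shift_sum_def)
  ultimately show ?case
    by (simp only:)
qed

section \<open>Averages over boxes\<close>

primrec box_sum :: "nat \<Rightarrow> (int ^ 'n) list \<Rightarrow> (int ^ 'n \<Rightarrow> int) \<Rightarrow> int ^ 'n \<Rightarrow> int" where
  "box_sum q [] h = h"
| "box_sum q (w # ws) h = (\<lambda>x. \<Sum>t<q. box_sum q ws h (x + int t *s w))"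

lemma box_sum_sum: "box_sum q ws (\<lambda>x. \<Sum>k\<in>K. h k x) x = (\<Sum>k\<in>K. box_sum q ws (h k) x)"
proof (induction ws arbitrary: x)
  case (Cons w ws)
  then show ?case by (simp add: sum.swap[of _ K])
qed simp

lemma box_sum_diff: "box_sum q ws (\<lambda>x. g x - h x) x = box_sum q ws g x - box_sum q ws h x"
  by (induction ws arbitrary: x) (auto simp: sum_subtractf)

lemma box_sum_translate: "box_sum q ws (\<lambda>x. h (x + u)) x = box_sum q ws h (x + u)"
  by (induction ws arbitrary: x) (auto simp: algebra_simps)

lemma box_sum_nonneg:
  assumes "\<And>x. 0 \<le> h x"
  shows "0 \<le> box_sum q ws h x"
  by (induction ws arbitrary: x) (auto simp: assms intro!: sum_nonneg)

text \<open>The term with all coefficients 0 is \<open>h x\<close> itself, and nonnegative terms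
  with sum 0 all vanish.\<close>

lemma box_sum_eq_0D:
  assumes "\<And>x. 0 \<le> h x" and "box_sum q ws h x = 0" and "0 < q"
  shows "h x = 0"
  using assms(2)
proof (induction ws)
  case (Cons w ws)
  have "\<forall>t\<in>{..<q}. box_sum q ws h (x + int t *s w) = 0"
    using Cons.prems box_sum_nonneg[of h] assms(1)
    by (subst sum_nonneg_eq_0_iff[symmetric]) auto
  then have "box_sum q ws h (x + int 0 *s w) = 0"
    using \<open>0 < q\<close> by blast
  then show ?case
    using Cons.IH by simp
qed simp

text \<open>Moving the box by \<open>w\<close> trades the layer \<open>t = 0\<close> for the layer
  \<open>t = q\<close>, and periodicity makes these equal.\<close>

lemma box_sum_invariant:
  assumes "\<And>w x. w \<in> set ws \<Longrightarrow> h (x + int q *s w) = h x" and "w \<in> set ws"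
  shows "box_sum q ws h (x + w) = box_sum q ws h x"
  using assms
proof (induction ws arbitrary: x)
  case (Cons w' ws)
  show ?case
  proof (cases "w \<in> set ws")
    case True
    have "box_sum q ws h (x + w + int t *s w') = box_sum q ws h (x + int t *s w')" for t
      using Cons.IH[OF _ True, of "x + int t *s w'"] Cons.prems(1) by (simp add: add_ac)
    then show ?thesis by simp
  next
    case False
    then have w: "w = w'"
      using Cons.prems(2) by simp
    let ?g = "\<lambda>t. box_sum q ws h (x + int t *s w)"
    have "?g q = box_sum q ws (\<lambda>y. h (y + int q *s w)) x"
      by (simp add: box_sum_translate)
    also have "\<dots> = ?g 0"
      using Cons.prems(1)[of w] w by simp
    finally have "?g q = ?g 0" .
    moreover have "(\<Sum>t<Suc q. ?g t) = ?g 0 + (\<Sum>t<q. ?g (Suc t))"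
      by (rule sum.lessThan_Suc_shift)
    ultimately have "(\<Sum>t<q. ?g (Suc t)) = (\<Sum>t<q. ?g t)"
      by simp
    moreover have "x + w + int t *s w = x + int (Suc t) *s w" for t
      by (simp add: vec_eq_iff algebra_simps)
    ultimately show ?thesis
      using w by (simp only: box_sum.simps)
  qed
qed simp

section \<open>Tilings of prime size\<close>

text \<open>Uniqueness is required of the index rather than of the element, so that sums over the
  tile become sums over \<open>{..<q}\<close>.\<close>

locale prime_tiling =
  fixes q :: nat and v :: "nat \<Rightarrow> int ^ 'n" and L :: "(int ^ 'n) set"
  assumes prime_q: "prime q"
    and v_0: "v 0 = 0"
    and generates: "group_closure (v ` {..<q}) = UNIV"
    and tiles: "\<And>x. \<exists>!i. i < q \<and> x - v i \<in> L"
begin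

definition ind :: "int ^ 'n \<Rightarrow> int" where
  "ind x = of_bool (x \<in> L)"

lemma q_gt_1: "1 < q"
  using prime_q prime_gt_1_nat by blast

lemma sum_ind_eq_card: "finite K \<Longrightarrow> (\<Sum>k\<in>K. ind (g k)) = int (card {k\<in>K. g k \<in> L})"
  unfolding ind_def by (simp add: sum.If_cases of_bool_def Int_def)

lemma shift_sum_ind: "shift_sum {..<q} v ind = (\<lambda>_. 1)"
proof
  fix x
  have "is_singleton {i\<in>{..<q}. x - v i \<in> L}"
    using tiles[of x] by (auto simp: is_singleton_iff_ex1)
  then show "shift_sum {..<q} v ind x = 1"
    by (simp add: shift_sum_def sum_ind_eq_card is_singleton_altdef)
qed

section \<open>Periodicity under \<open>q V\<close>\<close>

text \<open>One application of the operator yields the constant 1, and each of the other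
  \<open>r - 1\<close> multiplies it by \<open>q\<close>; Frobenius rewrites the power. A general
  \<open>u\<close> allows passing from one multiple of \<open>V\<close> to the next.\<close>

lemma shift_sum_multiple_cong:
  assumes "prime r" and "shift_sum {..<q} u ind = (\<lambda>_. 1)"
  shows "[shift_sum {..<q} (\<lambda>i. int r *s u i) ind x = int q ^ (r - 1)] (mod int r)"
proof -
  have "r = Suc (r - 1)"
    using \<open>prime r\<close> prime_gt_0_nat by auto
  then have "(shift_sum {..<q} u ^^ r) ind = (shift_sum {..<q} u ^^ (r - 1)) (shift_sum {..<q} u ind)"
    by (metis comp_apply funpow_Suc_right)
  also have "\<dots> = (\<lambda>_. int q ^ (r - 1))"
    by (simp add: assms(2) shift_sum_const_funpow)
  finally show ?thesis
    using shift_sum_frobenius[OF assms(1), of "{..<q}" u ind x] by (simp add: cong_sym)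
qed

text \<open>The number of \<open>i\<close> with \<open>x - int q *s v i \<in> L\<close> is divisible
  by \<open>q\<close> and at most \<open>q\<close>, so all \<open>i\<close> qualify or none. The
  index 0 stands for \<open>x\<close> itself.\<close>

lemma ind_periodic_minus:
  assumes "i < q"
  shows "x - int q *s v i \<in> L \<longleftrightarrow> x \<in> L"
proof -
  define K where "K = {i\<in>{..<q}. x - int q *s v i \<in> L}"
  have "[int (card K) = int q ^ (q - 1)] (mod int q)"
    using shift_sum_multiple_cong[OF prime_q shift_sum_ind, of x]
    by (simp add: shift_sum_def sum_ind_eq_card K_def)
  moreover have "[int q ^ (q - 1) = 0] (mod int q)"
    using q_gt_1 by (simp add: cong_0_iff)
  ultimately have "int q dvd int (card K)"
    using cong_0_iff cong_trans by blast
  then have dvd: "q dvd card K" by simp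
  have sub: "K \<subseteq> {..<q}" by (auto simp: K_def)
  then have fin: "finite K" "card K \<le> q"
    using finite_subset card_mono[of "{..<q}" K] by auto
  then have "card K = 0 \<or> card K = q"
    using dvd_imp_le[OF dvd] by linarith
  then have "K = {} \<or> K = {..<q}"
    using card_subset_eq[OF _ sub] fin by auto
  moreover have "0 \<in> K \<longleftrightarrow> x \<in> L"
    using q_gt_1 by (simp add: v_0 K_def)
  moreover have "i \<in> K \<longleftrightarrow> x - int q *s v i \<in> L"
    using assms by (simp add: K_def)
  moreover have "0 \<in> {..<q}" "i \<in> {..<q}"
    using assms by auto
  ultimately show ?thesis
    by blast
qed

lemma periodic:
  assumes "i < q"
  shows "x + (int q * m) *s v i \<in> L \<longleftrightarrow> x \<in> L"
proof -
  have nat: "x + (int q * int k) *s v i \<in> L \<longleftrightarrow> x \<in> L" for x k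
  proof (induction k)
    case (Suc k)
    have "x + (int q * int k) *s v i = x + (int q * int (Suc k)) *s v i - int q *s v i"
      by (simp add: vec_eq_iff algebra_simps)
    then show ?case
      using ind_periodic_minus[OF assms, of "x + (int q * int (Suc k)) *s v i"] Suc by metis
  qed simp
  show ?thesis
  proof (cases m rule: int_cases2)
    case (nonneg k)
    then show ?thesis using nat by simp
  next
    case (nonpos k)
    have "(x + (int q * m) *s v i) + (int q * int k) *s v i = x"
      by (simp add: nonpos vec_eq_iff)
    then show ?thesis
      using nat[of "x + (int q * m) *s v i" k] by (simp only:)
  qed
qed

text \<open>The translations preserving \<open>P\<close> at every point form a group containing the
  generators.\<close>

lemma vectors_invariant_induct:
  assumes "\<And>i x. i < q \<Longrightarrow> P (x + v i) \<longleftrightarrow> P x"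
  shows "P x \<longleftrightarrow> P 0"
proof -
  have "\<forall>y. P (y + x) \<longleftrightarrow> P y" if "x \<in> group_closure (v ` {..<q})" for x
    using that
  proof induction
    case (base s)
    then show ?case using assms by auto
  next
    case (diff s t)
    then show ?case
      by (metis add_diff_eq diff_add_cancel diff_add_eq)
  qed
  then have "P (0 + x) \<longleftrightarrow> P 0"
    using generates by blast
  then show ?thesis by simp
qed

text \<open>
  Averaging: summing over the box spanned by the generators turns \<open>ind\<close> into a constant, so a sum
  of \<open>q\<close> shifts of \<open>ind\<close> has mean value 1.
\<close>
lemma sum_shifts_ind_eq_1:
  assumes "card K = q"
    and "(\<forall>x. (\<Sum>k\<in>K. ind (x + u k)) \<le> 1) \<or> (\<forall>x. 1 \<le> (\<Sum>k\<in>K. ind (x + u k)))"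
  shows "(\<Sum>k\<in>K. ind (x + u k)) = 1"
proof -
  let ?A = "box_sum q (map v [0..<q])"
  let ?h = "\<lambda>x. \<Sum>k\<in>K. ind (x + u k)"
  have "ind (x + int q *s w) = ind x" if "w \<in> set (map v [0..<q])" for w x
    using that periodic[of _ x 1] by (auto simp: ind_def)
  then have "?A ind (x + v i) = ?A ind x" if "i < q" for i x
    using that by (intro box_sum_invariant) auto
  then have "(?A ind x = ?A ind 0) = (?A ind 0 = ?A ind 0)" for x
    by (intro vectors_invariant_induct) simp
  then obtain C where const: "\<And>x. ?A ind x = C"
    by blast
  have "?A ?h x = int q * C"
    using assms(1) by (simp add: box_sum_sum box_sum_translate const)
  \<comment> \<open>The tiling identity gives the box sum of 1 in terms of the same
    \<open>C\<close>, so \<open>C\<close> itself is never computed.\<close>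
  moreover have "?A (\<lambda>x. \<Sum>i<q. ind (x + - v i)) x = int q * C"
    by (simp only: box_sum_sum box_sum_translate const) simp
  moreover have "(\<lambda>_. 1) = (\<lambda>x. \<Sum>i<q. ind (x + - v i))"
    using shift_sum_ind by (simp add: shift_sum_def[abs_def])
  ultimately have eq: "?A (\<lambda>_. 1) x = ?A ?h x"
    by simp
  have "q > 0" using q_gt_1 by simp
  show ?thesis
    using assms(2)
  proof
    assume "\<forall>x. ?h x \<le> 1"
    then have "0 \<le> 1 - ?h y" for y
      by (simp only: diff_ge_0_iff_ge)
    moreover have "?A (\<lambda>x. 1 - ?h x) x = 0"
      using eq by (simp only: box_sum_diff)
    ultimately have "1 - ?h x = 0"
      using \<open>q > 0\<close> by (rule box_sum_eq_0D)
    then show ?thesis by simp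
  next
    assume "\<forall>x. 1 \<le> ?h x"
    then have "0 \<le> ?h y - 1" for y
      by (simp only: diff_ge_0_iff_ge)
    moreover have "?A (\<lambda>x. ?h x - 1) x = 0"
      using eq by (simp only: box_sum_diff)
    ultimately have "?h x - 1 = 0"
      using \<open>q > 0\<close> by (rule box_sum_eq_0D)
    then show ?thesis by simp
  qed
qed

section \<open>Tilings by multiples of \<open>V\<close> and intersections with lines\<close>

text \<open>Prime factors \<open>r\<close> of \<open>k\<close> are peeled off. As \<open>r\<close>
  differs from \<open>q\<close>, the covering number is nonzero modulo \<open>r\<close>, hence at
  least 1 everywhere, and averaging forces it to be 1.\<close>

lemma multiple_tiles:
  assumes "\<not> q dvd k"
  shows "shift_sum {..<q} (\<lambda>i. int k *s v i) ind = (\<lambda>_. 1)"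
  using assms
proof (induction k rule: less_induct)
  case (less k)
  show ?case
  proof (cases "k = 1")
    case True
    then show ?thesis
      using shift_sum_ind by simp
  next
    case False
    then obtain r where r: "prime r" "r dvd k"
      using prime_factor_nat by blast
    then obtain m where k: "k = r * m"
      by blast
    have "k \<noteq> 0"
      using less.prems by (metis dvd_0_right)
    then have "m < k"
      using k prime_gt_1_nat[OF r(1)] by simp
    moreover have "\<not> q dvd m"
      using less.prems k by auto
    ultimately have IH: "shift_sum {..<q} (\<lambda>i. int m *s v i) ind = (\<lambda>_. 1)"
      by (rule less.IH)
    have "\<not> r dvd q"
      using r less.prems prime_q primes_dvd_imp_eq by blast
    then have "\<not> int r dvd int q ^ (r - 1)"
      using r(1) prime_dvd_power by (metis int_dvd_int_iff of_nat_power)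
    have "1 \<le> (\<Sum>i<q. ind (x + - (int k *s v i)))" for x
    proof -
      have "[(\<Sum>i<q. ind (x + - (int k *s v i))) = int q ^ (r - 1)] (mod int r)"
        using shift_sum_multiple_cong[OF r(1) IH, of x]
        by (simp add: shift_sum_def k vector_smult_assoc)
      then have "(\<Sum>i<q. ind (x + - (int k *s v i))) \<noteq> 0"
        using \<open>\<not> int r dvd int q ^ (r - 1)\<close> by (metis cong_0_iff cong_sym)
      moreover have "0 \<le> (\<Sum>i<q. ind (x + - (int k *s v i)))"
        by (intro sum_nonneg) (simp add: ind_def)
      ultimately show ?thesis by linarith
    qed
    then have "(\<Sum>i<q. ind (x + - (int k *s v i))) = 1" for x
      by (intro sum_shifts_ind_eq_1) auto
    then show ?thesis
      by (simp add: shift_sum_def[abs_def])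
  qed
qed

text \<open>Otherwise the point \<open>l + s *s v i\<close> would be covered twice by the tiling
  with the multiple \<open>s\<close> of \<open>V\<close>, through the indices \<open>i\<close> and
  \<open>j\<close>.\<close>

lemma dvd_if_both_in:
  assumes "l \<in> L" and "l + s *s (v i - v j) \<in> L" and "i < q" "j < q" "i \<noteq> j"
  shows "int q dvd s"
proof (rule ccontr)
  assume s: "\<not> int q dvd s"
  \<comment> \<open>\<open>s\<close> may be negative; periodicity under \<open>q V\<close> permits
    replacing it by its residue.\<close>
  define k where "k = nat (s mod int q)"
  have k: "int k = s mod int q"
    using q_gt_1 by (simp add: k_def)
  have "\<not> int q dvd int k"
    using s unfolding k by (simp add: dvd_mod_iff)
  then have tile: "shift_sum {..<q} (\<lambda>i. int k *s v i) ind = (\<lambda>_. 1)"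
    by (intro multiple_tiles) simp
  define x where "x = l + s *s v i"
  have reduce: "x - int k *s v m \<in> L \<longleftrightarrow> x - s *s v m \<in> L" if "m < q" for m
  proof -
    have "s = int q * (s div int q) + int k"
      unfolding k by simp
    then have "x - int k *s v m = x - s *s v m + (int q * (s div int q)) *s v m"
      by (metis (no_types, lifting) add_diff_cancel_right' diff_add_eq diff_diff_eq2 vector_sadd_rdistrib)
    then show ?thesis
      using periodic[OF that] by (simp only:)
  qed
  have "x - s *s v i = l" "x - s *s v j = l + s *s (v i - v j)"
    by (simp_all add: x_def vec_eq_iff algebra_simps)
  then have "i \<in> {m\<in>{..<q}. x - int k *s v m \<in> L}" "j \<in> {m\<in>{..<q}. x - int k *s v m \<in> L}"
    using assms reduce by auto
  moreover have "card {m\<in>{..<q}. x - int k *s v m \<in> L} = 1"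
    using fun_cong[OF tile, of x] by (simp add: shift_sum_def sum_ind_eq_card)
  ultimately show False
    using \<open>i \<noteq> j\<close> by (metis card_1_singletonE singletonD)
qed

text \<open>Among \<open>q\<close> consecutive points at most one lies in \<open>L\<close>, by
  \<open>dvd_if_both_in\<close>, and averaging turns this bound into equality.\<close>

lemma line_meets:
  assumes "i < q" "j < q" "i \<noteq> j"
  shows "\<exists>t<q. x + int t *s (v i - v j) \<in> L"
proof -
  have "(\<Sum>t<q. ind (x + int t *s (v i - v j))) \<le> 1" for x
  proof -
    have "t = t'" if t: "t < q" "t' < q" "x + int t *s (v i - v j) \<in> L" "x + int t' *s (v i - v j) \<in> L" for t t'
    proof -
      have "x + int t' *s (v i - v j) = (x + int t *s (v i - v j)) + (int t' - int t) *s (v i - v j)"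
        by (simp add: vec_eq_iff algebra_simps)
      then have "int q dvd int t' - int t"
        using dvd_if_both_in[OF t(3) _ assms] t(4) by (simp only:)
      then have "[t' = t] (mod q)"
        by (simp add: cong_iff_dvd_diff flip: cong_int_iff)
      then show ?thesis
        using t by (simp add: cong_def)
    qed
    then have "card {t\<in>{..<q}. x + int t *s (v i - v j) \<in> L} \<le> Suc 0"
      by (subst card_le_Suc0_iff_eq) auto
    then show ?thesis
      by (simp add: sum_ind_eq_card)
  qed
  then have "(\<Sum>t<q. ind (x + int t *s (v i - v j))) = 1"
    by (intro sum_shifts_ind_eq_1) auto
  moreover have "(\<Sum>t<q. ind (x + int t *s (v i - v j))) = 0"
    if "\<not> (\<exists>t<q. x + int t *s (v i - v j) \<in> L)"
    using that by (intro sum.neutral) (auto simp: ind_def)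
  ultimately show ?thesis
    by fastforce
qed

section \<open>The height function\<close>

text \<open>The choice picks an arbitrary representative: only the class modulo \<open>q\<close> is
  determined, so every later fact about heights is a congruence.\<close>

definition height :: "int ^ 'n \<Rightarrow> int" where
  "height y = (SOME t. y - t *s v 1 \<in> L)"

lemma height_in: "y - height y *s v 1 \<in> L"
proof -
  obtain t where "y + int t *s (v 1 - v 0) \<in> L"
    using line_meets[of 1 0 y] q_gt_1 by auto
  then have "y - (- int t) *s v 1 \<in> L"
    by (simp add: v_0 vector_smult_lneg)
  then show ?thesis
    unfolding height_def by (rule someI)
qed

lemma height_cong_iff: "[height y = s] (mod int q) \<longleftrightarrow> y - s *s v 1 \<in> L"
proof
  assume "[height y = s] (mod int q)"
  then obtain m where "height y - s = int q * m"
    by (auto simp: cong_iff_dvd_diff)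
  then have "height y = s + int q * m"
    by simp
  then have "y - s *s v 1 = y - height y *s v 1 + (int q * m) *s v 1"
    by (simp add: vec_eq_iff algebra_simps)
  then show "y - s *s v 1 \<in> L"
    using periodic[OF q_gt_1] height_in[of y] by (simp only:)
next
  assume s: "y - s *s v 1 \<in> L"
  have "y - height y *s v 1 = y - s *s v 1 + (s - height y) *s (v 1 - v 0)"
    by (simp add: v_0 vec_eq_iff algebra_simps)
  then have "int q dvd s - height y"
    using dvd_if_both_in[OF s _ q_gt_1 _ one_neq_zero, of "s - height y"] height_in[of y] q_gt_1
    by (simp only: less_trans[OF zero_less_one])
  then show "[height y = s] (mod int q)"
    by (simp add: cong_iff_dvd_diff dvd_diff_commute)
qed

lemma height_add_v1: "[height (y + s *s v 1) = height y + s] (mod int q)"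
proof -
  have "y + s *s v 1 - (height y + s) *s v 1 = y - height y *s v 1"
    by (simp add: vec_eq_iff algebra_simps)
  then show ?thesis
    unfolding height_cong_iff using height_in[of y] by (simp only:)
qed

lemma height_periodic:
  assumes "i < q"
  shows "[height (y + (int q * m) *s v i) = height y] (mod int q)"
proof -
  have "y + (int q * m) *s v i - height y *s v 1 = y - height y *s v 1 + (int q * m) *s v i"
    by simp
  then show ?thesis
    unfolding height_cong_iff using height_in[of y] periodic[OF assms] by (simp only:)
qed

text \<open>Each coincidence yields two points of \<open>L\<close> that differ by \<open>s\<close>
  times \<open>v i - v 0\<close>, \<open>v i - v 1\<close> or \<open>v i - v j\<close>,
  respectively.\<close>

lemma height_collisions:
  assumes "2 \<le> i" "i < q"
  shows "[height (y + s *s v i) = height y] (mod int q) \<Longrightarrow> int q dvd s"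
    and "[height (y + s *s v i) = height y + s] (mod int q) \<Longrightarrow> int q dvd s"
    and "j < q \<Longrightarrow> i \<noteq> j \<Longrightarrow> [height (y + s *s v i) = height (y + s *s v j)] (mod int q) \<Longrightarrow> int q dvd s"
proof -
  have less: "0 < q" "1 < q" and neq: "i \<noteq> 0" "i \<noteq> 1"
    using assms by auto
  have "y + s *s v i - height y *s v 1 = y - height y *s v 1 + s *s (v i - v 0)"
    by (simp add: v_0)
  then show "int q dvd s" if "[height (y + s *s v i) = height y] (mod int q)"
    using dvd_if_both_in[OF height_in _ assms(2) less(1) neq(1), of y s] that
    unfolding height_cong_iff by (simp only:)
  have "y + s *s v i - (height y + s) *s v 1 = y - height y *s v 1 + s *s (v i - v 1)"
    by (simp add: vec_eq_iff algebra_simps)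
  then show "int q dvd s" if "[height (y + s *s v i) = height y + s] (mod int q)"
    using dvd_if_both_in[OF height_in _ assms(2) less(2) neq(2), of y s] that
    unfolding height_cong_iff by (simp only:)
  have "y + s *s v i - h *s v 1 = y + s *s v j - h *s v 1 + s *s (v i - v j)" for h
    by (simp add: vec_eq_iff algebra_simps)
  then show "int q dvd s" if "j < q" "i \<noteq> j" "[height (y + s *s v i) = height (y + s *s v j)] (mod int q)"
    using dvd_if_both_in[OF height_in _ assms(2) that(1,2), of "y + s *s v j" s] that(3)
    unfolding height_cong_iff by (simp only:)
qed

lemma height_orthomorphism:
  assumes "2 \<le> j" "j < q"
  shows "orthomorphism (int q) (\<lambda>t. height (y + t *s v j))"
  unfolding orthomorphism_def
proof (intro conjI allI impI)
  fix s t
  have eq: "y + s *s v j = (y + t *s v j) + (s - t) *s v j"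
    by (simp add: vec_eq_iff algebra_simps)
  show "[s = t] (mod int q)" if "[height (y + s *s v j) = height (y + t *s v j)] (mod int q)"
    using height_collisions(1)[OF assms, of "y + t *s v j" "s - t"] that
    unfolding eq cong_iff_dvd_diff by simp
  show "[s = t] (mod int q)"
    if "[height (y + s *s v j) - s = height (y + t *s v j) - t] (mod int q)"
    using height_collisions(2)[OF assms, of "y + t *s v j" "s - t"] that
    unfolding eq cong_iff_dvd_diff by (simp add: algebra_simps)
qed

lemma height_row_shift:
  assumes "2 \<le> i" "i < q" "j < q" "i \<noteq> j" "0 < d" "d < q"
  shows "row_shift q d (\<lambda>t. height (y + t *s v j)) (\<lambda>t. height (y + int d *s v i + t *s v j))"
  unfolding row_shift_def
proof (intro allI conjI notI)
  fix t
  have d: "\<not> int q dvd int d"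
    using assms by (auto dest: nat_dvd_not_less)
  have eq: "y + int d *s v i + t *s v j = (y + t *s v j) + int d *s v i"
    "y + (t + int d) *s v j = (y + t *s v j) + int d *s v j"
    by (simp_all add: vec_eq_iff algebra_simps)
  note collisions = height_collisions(1,2)[OF assms(1,2), of "y + t *s v j" "int d"]
    height_collisions(3)[OF assms(1-4), of "y + t *s v j" "int d"]
  show False if "[height (y + int d *s v i + t *s v j) = height (y + t *s v j)] (mod int q)"
    using collisions(1) that d unfolding eq by blast
  show False if "[height (y + int d *s v i + t *s v j) = height (y + t *s v j) + int d] (mod int q)"
    using collisions(2) that d unfolding eq by blast
  show False if "[height (y + int d *s v i + t *s v j) = height (y + (t + int d) *s v j)] (mod int q)"
    using collisions(3) that d unfolding eq by blast
qed

section \<open>Affinity of the height\<close>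

lemma height_affine_nat:
  assumes "q \<le> 7" "2 \<le> j" "j < q" "k < q"
  shows "[height (y + int k *s v j) = height y + int k * (height (y + v j) - height y)] (mod int q)"
proof -
  \<comment> \<open>The bounds on \<open>j\<close> exclude \<open>q = 2\<close>.\<close>
  have "q = 3 \<or> q = 4 \<or> q = 5 \<or> q = 6 \<or> q = 7"
    using assms by auto
  moreover have "q \<noteq> 4" "q \<noteq> 6"
    using prime_q by auto
  ultimately consider "q = 3 \<or> q = 5" | "q = 7"
    by blast
  then show ?thesis
  proof cases
    case 1
    then show ?thesis
      using orthomorphism_3_5_affine[OF height_orthomorphism[OF assms(2,3)], of k y] assms by simp
  next
    case 2
    \<comment> \<open>Any second direction other than \<open>j\<close> serves; the rows used start
      at \<open>y\<close>, \<open>y + v i\<close> and \<open>y + 6 v i\<close>.\<close>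
    define i where "i = (if j = 2 then 3 else 2 :: nat)"
    have i: "2 \<le> i" "i < q" "i \<noteq> j"
      using 2 by (auto simp: i_def)
    let ?row = "\<lambda>y t. height (y + t *s v j)"
    have per: "[?row y (t + 7) = ?row y t] (mod 7)" for y t
    proof -
      have "y + (t + 7) *s v j = (y + t *s v j) + (int q * 1) *s v j"
        by (simp add: 2 vec_eq_iff algebra_simps)
      then show ?thesis
        using height_periodic[OF assms(3), of "y + t *s v j" 1] by (simp only: 2 of_nat_numeral)
    qed
    have ortho: "orthomorphism 7 (?row y)" for y
      using height_orthomorphism[OF assms(2,3), of y] 2 by simp
    have shifts: "row_shift 7 d (?row y) (?row (y + int d *s v i))" if "0 < d" "d < 7" for d y
      using height_row_shift[OF i(1,2) assms(3) i(3), of d y] that 2 by simp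
    have shift5: "row_shift 7 5 (?row (y + int 1 *s v i)) (?row (y + int 6 *s v i))"
    proof -
      have "y + int 1 *s v i + int 5 *s v i = y + int 6 *s v i"
        by (simp add: vec_eq_iff)
      then show ?thesis
        using shifts[of 5 "y + int 1 *s v i", OF zero_less_numeral] by (simp only:)
    qed
    have "[?row y (int k) = ?row y 0 + int k * (?row y 1 - ?row y 0)] (mod 7)"
      using orthomorphism_7_affine[OF ortho ortho ortho per per shifts shifts shift5] assms(4) 2 by simp
    then show ?thesis
      by (simp add: 2)
  qed
qed

lemma height_affine:
  assumes "q \<le> 7" "2 \<le> j" "j < q"
  shows "[height (y + t *s v j) = height y + t * (height (y + v j) - height y)] (mod int q)"
proof -
  define k where "k = nat (t mod int q)"
  have k: "int k = t mod int q"
    using q_gt_1 by (simp add: k_def)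
  have "k < q"
    using q_gt_1 by (simp add: k_def nat_less_iff)
  have t: "t = int q * (t div int q) + int k"
    unfolding k by simp
  have "y + t *s v j = (y + int k *s v j) + (int q * (t div int q)) *s v j"
    by (subst t) (simp add: vec_eq_iff algebra_simps)
  then have "[height (y + t *s v j) = height (y + int k *s v j)] (mod int q)"
    using height_periodic[OF assms(3)] by (simp only:)
  also have "[height (y + int k *s v j) = height y + int k * (height (y + v j) - height y)] (mod int q)"
    using height_affine_nat[OF assms \<open>k < q\<close>] .
  also have "[height y + int k * (height (y + v j) - height y) =
      height y + t * (height (y + v j) - height y)] (mod int q)"
    unfolding k by (intro cong_add cong_mult cong_refl) (simp add: cong_def)
  finally show ?thesis .
qed

text \<open>The slope along \<open>v j\<close> is itself affine along \<open>v i\<close>. An affine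
  function modulo a prime with nonzero increment \<open>d\<close> has a root, but slopes never
  vanish, so \<open>d\<close> is 0 modulo \<open>q\<close>.\<close>

lemma height_slope_step:
  assumes "q \<le> 7" "2 \<le> j" "j < q" "i < q"
  shows "[height (y + v i + v j) - height (y + v i) = height (y + v j) - height y] (mod int q)"
proof -
  let ?slope = "\<lambda>y. height (y + v j) - height y"
  have nonzero: "\<not> [?slope y = 0] (mod int q)" for y
    using height_collisions(1)[OF assms(2,3), of y 1] q_gt_1 by (auto simp: cong_diff_iff_cong_0)
  have swap: "x + v j + s *s v i = x + s *s v i + v j" for x s
    by (simp add: add_ac)
  consider "i = 0" | "i = 1" | "2 \<le> i"
    by linarith
  then show ?thesis
  proof cases
    case 1
    then show ?thesis by (simp add: v_0)
  next
    case 2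
    have "[height (y + v j + 1 *s v 1) - height (y + 1 *s v 1) =
        (height (y + v j) + 1) - (height y + 1)] (mod int q)"
      by (intro cong_diff height_add_v1)
    then show ?thesis
      using swap[of y 1] 2 by (simp add: add_ac)
  next
    case 3
    define d where "d = ?slope (y + v i) - ?slope y"
    have slope: "[?slope (y + s *s v i) = ?slope y + s * d] (mod int q)" for s
    proof -
      have "[height (y + v j + s *s v i) - height (y + s *s v i) =
          (height (y + v j) + s * (height (y + v j + v i) - height (y + v j))) -
          (height y + s * (height (y + v i) - height y))] (mod int q)"
        by (intro cong_diff height_affine assms(1,4) 3)
      moreover have "y + v j + v i = y + v i + v j"
        by (simp add: add_ac)
      ultimately show ?thesis
        by (simp add: swap d_def algebra_simps)
    qed
    have "int q dvd d"
    proof (rule ccontr)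
      assume "\<not> int q dvd d"
      then have "coprime d (int q)"
        using prime_q by (metis coprime_commute prime_imp_coprime prime_nat_int_transfer)
      then obtain e where "[d * e = 1] (mod int q)"
        using cong_solve_coprime_int by blast
      \<comment> \<open>With \<open>e\<close> inverse to \<open>d\<close>, the root is at
        \<open>s = - (?slope y * e)\<close>.\<close>
      then have "[?slope y + (- ?slope y) * (d * e) = ?slope y + (- ?slope y) * 1] (mod int q)"
        by (intro cong_add cong_mult cong_refl)
      then have "[?slope y + (- (?slope y * e)) * d = 0] (mod int q)"
        by (simp add: algebra_simps)
      then show False
        using slope nonzero cong_trans by blast
    qed
    then show ?thesis
      by (simp add: d_def cong_iff_dvd_diff)
  qed
qed

lemma height_add_vector:
  assumes "q \<le> 7" "i < q"
  shows "[height (y + v i) - height y = height (v i) - height 0] (mod int q)"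
proof -
  consider "i = 0" | "i = 1" | "2 \<le> i"
    by linarith
  then show ?thesis
  proof cases
    case 1
    then show ?thesis by (simp add: v_0)
  next
    case 2
    have "[height (y + 1 *s v 1) - height y = (height y + 1) - height y] (mod int q)"
      "[height (0 + 1 *s v 1) - height 0 = (height 0 + 1) - height 0] (mod int q)"
      by (intro cong_diff height_add_v1 cong_refl)+
    then have "[height (y + v i) - height y = 1] (mod int q)" "[height (v i) - height 0 = 1] (mod int q)"
      using 2 by simp_all
    then show ?thesis
      using cong_sym cong_trans by blast
  next
    case 3
    let ?P = "\<lambda>y. [height (y + v i) - height y = height (v i) - height 0] (mod int q)"
    have "?P (y + v k) \<longleftrightarrow> ?P y" if "k < q" for k y
      using height_slope_step[OF assms(1) 3 assms(2) that, of y] cong_sym cong_trans by blast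
    then have "?P y \<longleftrightarrow> ?P 0"
      by (rule vectors_invariant_induct)
    then show ?thesis by simp
  qed
qed

text \<open>Adding a generator to \<open>y\<close> changes \<open>height (x + y)\<close> and
  \<open>height y\<close> by the same amount, so their difference may be evaluated at
  \<open>y = 0\<close>.\<close>

lemma height_add:
  assumes "q \<le> 7"
  shows "[height (x + y) - height y = height x - height 0] (mod int q)"
proof -
  let ?P = "\<lambda>y. [height (x + y) - height y = height x - height 0] (mod int q)"
  have "?P (y + v i) \<longleftrightarrow> ?P y" if "i < q" for i y
  proof -
    have "[(height (x + y + v i) - height (x + y)) - (height (y + v i) - height y) =
        (height (v i) - height 0) - (height (v i) - height 0)] (mod int q)"
      by (intro cong_diff height_add_vector assms that)
    then have "[height (x + (y + v i)) - height (y + v i) = height (x + y) - height y] (mod int q)"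
      by (simp add: cong_iff_dvd_diff algebra_simps)
    then show ?thesis
      using cong_sym cong_trans by blast
  qed
  then have "?P y \<longleftrightarrow> ?P 0"
    by (rule vectors_invariant_induct)
  then show ?thesis by simp
qed

text \<open>As \<open>height 0\<close> vanishes modulo \<open>q\<close>, the height is additive
  modulo \<open>q\<close>, and \<open>L\<close> is its kernel.\<close>

lemma add_subgroup_L:
  assumes "q \<le> 7" "0 \<in> L"
  shows "add_subgroup L"
proof -
  have L_iff: "y \<in> L \<longleftrightarrow> int q dvd height y" for y
    using height_cong_iff[of y 0] by (simp add: cong_0_iff)
  have "int q dvd height (x + y) - height x - height y" for x y
  proof -
    have "int q dvd (height (x + y) - height y) - (height x - height 0)"
      using height_add[OF assms(1), of x y] by (simp add: cong_iff_dvd_diff)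
    moreover have "int q dvd height 0"
      using assms(2) L_iff by blast
    ultimately have "int q dvd (height (x + y) - height y) - (height x - height 0) - height 0"
      by (rule dvd_diff)
    then show ?thesis by (simp add: algebra_simps)
  qed
  note add = this
  have closed: "x + y \<in> L \<longleftrightarrow> y \<in> L" if "x \<in> L" for x y
  proof -
    have "int q dvd height (x + y) - height x - height y + height x"
      using add that unfolding L_iff by (rule dvd_add)
    then have "int q dvd height (x + y) - height y"
      by (simp add: algebra_simps)
    then show ?thesis
      unfolding L_iff using dvd_diffD dvd_diffD1 by (metis diff_add_cancel dvd_add_right_iff)
  qed
  have "- x \<in> L" if "x \<in> L" for x
    using closed[OF that, of "- x"] assms(2) by simp
  then show ?thesis
    unfolding add_subgroup_def using closed assms(2) by blast
qed

end

section \<open>From the indexed setting to tilings by sets\<close>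

lemma tiling_translate:
  assumes "tiling V L"
  shows "tiling V ((+) t ` L)"
  unfolding tiling_def
proof
  fix x
  obtain p where p: "p \<in> V \<times> L" "x - t = fst p + snd p"
    and unique: "\<And>p'. p' \<in> V \<times> L \<Longrightarrow> x - t = fst p' + snd p' \<Longrightarrow> p' = p"
    using assms unfolding tiling_def by metis
  show "\<exists>!p. p \<in> V \<times> (+) t ` L \<and> x = fst p + snd p"
  proof (rule ex1I[of _ "(fst p, t + snd p)"])
    show "(fst p, t + snd p) \<in> V \<times> (+) t ` L \<and> x = fst (fst p, t + snd p) + snd (fst p, t + snd p)"
      using p by (auto simp: algebra_simps)
  next
    fix p' assume p': "p' \<in> V \<times> (+) t ` L \<and> x = fst p' + snd p'"
    then obtain a l where al: "p' = (a, t + l)" "a \<in> V" "l \<in> L"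
      by auto
    then have "(a, l) = p"
      using p' by (intro unique) (auto simp: algebra_simps)
    then show "p' = (fst p, t + snd p)"
      using al by auto
  qed
qed

lemma prime_tiling_lattice:
  fixes q :: nat and v :: "nat \<Rightarrow> int ^ 'n"
  assumes "prime q" and "q \<le> 7"
    and V: "V = insert 0 (v ` {1..q - 1})"
    and "card V = q"
    and gen: "group_closure (v ` {1..q - 1}) = UNIV"
    and tiling: "tiling V L"
    and "0 \<in> L"
  shows "lattice_tiling V L"
proof -
  \<comment> \<open>The value \<open>v 0\<close> is arbitrary; it is reset so that index 0 denotes
    the origin.\<close>
  define w where "w = v(0 := 0)"
  have "q > 0"
    using \<open>prime q\<close> prime_gt_0_nat by blast
  then have "{..<q} = insert 0 {1..q - 1}"
    by auto
  then have range: "w ` {..<q} = V"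
    unfolding V w_def by auto
  \<comment> \<open>The size \<open>q\<close> makes the enumeration injective, so uniqueness of the
    element becomes uniqueness of the index.\<close>
  then have inj: "inj_on w {..<q}"
    using \<open>card V = q\<close> by (intro eq_card_imp_inj_on) auto
  have "prime_tiling q w L"
  proof
    have "group_closure (v ` {1..q - 1}) \<subseteq> group_closure (w ` {..<q})"
    proof
      fix x assume "x \<in> group_closure (v ` {1..q - 1})"
      then show "x \<in> group_closure (w ` {..<q})"
        by induction (auto simp: range V intro: group_closure.intros)
    qed
    then show "group_closure (w ` {..<q}) = UNIV"
      using gen by blast
    fix x
    obtain p where p: "p \<in> V \<times> L" "x = fst p + snd p"
      and unique: "\<And>p'. p' \<in> V \<times> L \<Longrightarrow> x = fst p' + snd p' \<Longrightarrow> p' = p"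
      using tiling unfolding tiling_def by metis
    then obtain i where i: "i < q" "fst p = w i"
      using range by (metis imageE lessThan_iff mem_Times_iff)
    show "\<exists>!i. i < q \<and> x - w i \<in> L"
    proof (rule ex1I[of _ i])
      show "i < q \<and> x - w i \<in> L"
        using p i by auto
    next
      fix j assume j: "j < q \<and> x - w j \<in> L"
      then have "(w j, x - w j) = p"
        using range by (intro unique) auto
      then have "w j = w i"
        using i by auto
      then show "j = i"
        using inj i j by (auto dest: inj_onD)
    qed
  qed (use \<open>prime q\<close> in \<open>simp_all add: w_def\<close>)
  then show ?thesis
    using prime_tiling.add_subgroup_L assms unfolding lattice_tiling_def by blast
qed

theorem theorem23:
  fixes q :: nat and v :: "nat \<Rightarrow> int ^ 'n" and V L :: "(int ^ 'n) set"
  assumes "prime q" and "q \<le> 7"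
    and "V = insert 0 (v ` {1..q - 1})"
    and "card V = q"
    and "group_closure (v ` {1..q - 1}) = UNIV"
    and "tiling V L"
  shows "(0 \<in> L \<longrightarrow> lattice_tiling V L) \<and> (\<exists>t. lattice_tiling V ((+) t ` L))"
proof
  show "0 \<in> L \<longrightarrow> lattice_tiling V L"
    using prime_tiling_lattice[OF assms] by blast
  \<comment> \<open>\<open>L\<close> is nonempty because points are covered; translating by
    \<open>- l\<close> brings the origin into it.\<close>
  obtain l where "l \<in> L"
    using \<open>tiling V L\<close> unfolding tiling_def by (metis mem_Times_iff)
  then have "0 \<in> (+) (- l) ` L"
    by (force simp: image_iff)
  then have "lattice_tiling V ((+) (- l) ` L)"
    using prime_tiling_lattice[OF assms(1-5) tiling_translate[OF assms(6)]] by blast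
  then show "\<exists>t. lattice_tiling V ((+) t ` L)" ..
qed

end
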